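(* Let $P_n$ be the path with $n$ vertices, where $n\geq 1$. Then \[P_{P_n}^{\times}(z)=\begin{cases}\left(\frac{2^{n}-1}{3}\right)z^{n-1}+\left(\frac{2^{n+1}+1}{3}\right)z^{n}, & \text{if } n \text{ is even},\\[2pt] \left(\frac{2^{n}+1}{3}\right)z^{n-1}+\left(\frac{2^{n+1}-1}{3}\right)z^{n}, & \text{if } n \text{ is odd}.\end{cases}\]
   Context: A ribbon graph $G$ is a surface with boundary formed from vertex discs and edge discs (ribbons), each edge attached to vertex discs along two disjoint arcs; $v,e,f,c$ denote numbers of vertices, edges, boundary components and connected components, and the Euler genus is $\varepsilon=2c-v+e-f$. For $A\subseteq E(G)$, the partial Petrial $G^{\times|A}$ is obtained by adding a half-twist to each edge in $A$, and ${^\partial\varepsilon^{\times}_{G}(z)}=\sum_{A\subseteq E(G)} z^{\varepsilon(G^{\times|A})}$. A bouquet is a ribbon graph with one vertex; two loops are interlaced if their ends alternate around the vertex boundary; the intersection graph $I(B)$ has vertex set $E(B)$ with adjacency meaning interlaced. A circle graph is a graph $I(B)$ for some bouquet $B$, and for a circle graph $G$, $P_G^{\times}(z):={^\partial\varepsilon^{\times}_{B}(z)}$ for any bouquet $B$ with $I(B)=G$ (independent of the choice of $B$). *)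

theory Defs
  imports
    "HOL-Computational_Algebra.Polynomial"
    "Graph_Theory.Pair_Digraph"
    "Graph_Theory.Digraph_Isomorphism"
begin

section \<open>Ribbon graphs\<close>

text \<open>
  Ribbon graphs are encoded, up to homeomorphism, by signed rotation systems.  The ribbon of an
  edge \<open>e\<close> has the two ends \<open>(e, False)\<close> and \<open>(e, True)\<close>.  Every vertex disc is
  given an orientation and is represented by the list of the edge ends attached to its boundary
  circle, in the order in which they are met; the list is to be read cyclically, and an isolated
  vertex is the empty list.  The set \<open>twisted\<close> contains the edges whose ribbon is
  half-twisted with respect to the orientations of the discs at its two ends.  The order of the
  list of discs is irrelevant.
\<close>

record 'e ribbon_graph =
  discs :: "('e \<times> bool) list list"
  twisted :: "'e set"

definition edges :: "'e ribbon_graph \<Rightarrow> 'e set" where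
  "edges G = fst ` set (concat (discs G))"

definition wf_ribbon_graph :: "'e ribbon_graph \<Rightarrow> bool" where
  "wf_ribbon_graph G \<longleftrightarrow>
     distinct (concat (discs G)) \<and> set (concat (discs G)) = edges G \<times> UNIV \<and>
     twisted G \<subseteq> edges G"

text \<open>
  For \<open>R \<subseteq> V \<times> V\<close>, the number of connected components of the undirected graph on
  \<open>V\<close> whose edges are the pairs in \<open>R\<close>.
\<close>

definition num_components :: "'a set \<Rightarrow> 'a rel \<Rightarrow> nat" where
  "num_components V R = card (V // (R \<union> R\<inverse>)\<^sup>*)"

definition num_vertices :: "'e ribbon_graph \<Rightarrow> nat" where
  "num_vertices G = length (discs G)"

definition num_edges :: "'e ribbon_graph \<Rightarrow> nat" where
  "num_edges G = card (edges G)"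

definition num_conn_components :: "'e ribbon_graph \<Rightarrow> nat" where
  "num_conn_components G =
     num_components {..<length (discs G)}
       {(i, j). i < length (discs G) \<and> j < length (discs G) \<and>
          fst ` set (discs G ! i) \<inter> fst ` set (discs G ! j) \<noteq> {}}"

text \<open>
  The arc along which the edge end \<open>h\<close> is attached runs, in the orientation of the vertex
  disc, from the point \<open>(h, False)\<close> to the point \<open>(h, True)\<close>.  The boundary of the
  surface consists of the arcs of the vertex circles between consecutive edge ends, the two free
  sides of each ribbon, and the whole boundary circles of the isolated vertices.  The free sides of
  an untwisted ribbon join the initial point of each attaching arc to the terminal point of the
  other one; those of a half-twisted ribbon join initial to initial and terminal to terminal point.
\<close>

definition boundary_points :: "'e ribbon_graph \<Rightarrow> (('e \<times> bool) \<times> bool) set" where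
  "boundary_points G = (edges G \<times> UNIV) \<times> UNIV"

definition vertex_arcs :: "'e ribbon_graph \<Rightarrow> (('e \<times> bool) \<times> bool) rel" where
  "vertex_arcs G =
     {((d ! i, True), (d ! (Suc i mod length d), False)) | d i. d \<in> set (discs G) \<and> i < length d}"

definition ribbon_sides :: "'e ribbon_graph \<Rightarrow> (('e \<times> bool) \<times> bool) rel" where
  "ribbon_sides G =
     {(((e, b), s), ((e, \<not> b), if e \<in> twisted G then s else \<not> s)) | e b s. e \<in> edges G}"

definition num_boundary_components :: "'e ribbon_graph \<Rightarrow> nat" where
  "num_boundary_components G =
     num_components (boundary_points G) (vertex_arcs G \<union> ribbon_sides G)
     + count_list (discs G) []"

definition euler_genus :: "'e ribbon_graph \<Rightarrow> int" where
  "euler_genus G =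
     2 * int (num_conn_components G) - int (num_vertices G) + int (num_edges G)
     - int (num_boundary_components G)"

section \<open>Partial Petrials\<close>

definition partial_petrial :: "'e ribbon_graph \<Rightarrow> 'e set \<Rightarrow> 'e ribbon_graph" where
  "partial_petrial G A = G\<lparr>twisted := (twisted G - A) \<union> (A - twisted G)\<rparr>"

text \<open>The Euler genus of a ribbon graph is nonnegative, so \<open>nat\<close> does not truncate.\<close>

definition petrial_polynomial :: "'e ribbon_graph \<Rightarrow> rat poly" where
  "petrial_polynomial G =
     (\<Sum>A\<in>Pow (edges G). monom 1 (nat (euler_genus (partial_petrial G A))))"

section \<open>Bouquets and circle graphs\<close>

definition bouquet :: "'e ribbon_graph \<Rightarrow> bool" where
  "bouquet B \<longleftrightarrow> wf_ribbon_graph B \<and> num_vertices B = 1"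

text \<open>
  Alternation along a circle does not depend on where the circle is cut open.  The condition
  forces \<open>a \<noteq> b\<close>, since a single edge has only two ends.
\<close>

definition interlaced :: "'e ribbon_graph \<Rightarrow> 'e \<Rightarrow> 'e \<Rightarrow> bool" where
  "interlaced B a b \<longleftrightarrow>
     (\<exists>d\<in>set (discs B). filter (\<lambda>e. e = a \<or> e = b) (map fst d) \<in> {[a, b, a, b], [b, a, b, a]})"

text \<open>Simple graphs are represented as symmetric loopless digraphs without parallel arcs.\<close>

definition intersection_graph :: "'e ribbon_graph \<Rightarrow> 'e pair_pre_digraph" where
  "intersection_graph B = \<lparr>pverts = edges B, parcs = {(a, b). interlaced B a b}\<rparr>"

definition represents :: "'a ribbon_graph \<Rightarrow> 'a pair_pre_digraph \<Rightarrow> bool" where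
  "represents B G \<longleftrightarrow>
     bouquet B \<and> digraph_iso (with_proj (intersection_graph B)) (with_proj G)"

definition circle_graph :: "'a pair_pre_digraph \<Rightarrow> bool" where
  "circle_graph G \<longleftrightarrow> (\<exists>B. represents B G)"

text \<open>
  The common value of the polynomial over all bouquets representing \<open>G\<close>; the definite
  description is meaningful because this value does not depend on the bouquet.
\<close>

definition circle_petrial_polynomial :: "'a pair_pre_digraph \<Rightarrow> rat poly" where
  "circle_petrial_polynomial G = (THE p. \<exists>B. represents B G \<and> p = petrial_polynomial B)"

definition path_graph :: "nat \<Rightarrow> nat pair_pre_digraph" where
  "path_graph n =
     \<lparr>pverts = {1..n},
      parcs = {(i, j). i \<in> {1..n} \<and> j \<in> {1..n} \<and> (j = i + 1 \<or> i = j + 1)}\<rparr>"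

end

theory Submission
  imports Defs
begin

text \<open>
  Let \<open>M\<close> be the adjacency matrix of the intersection graph of a bouquet over the
  two-element field, with ones on the diagonal at the twisted edges.  Walking around the vertex,
  a union of boundary components amounts to a kernel vector of \<open>M\<close> together with the choice
  of whether it contains a fixed base point, so the number of boundary components is one plus the
  corank of \<open>M\<close>, and the Euler genus is the rank.  For the path, \<open>M\<close> is tridiagonal,
  so its corank is at most one, and the three-term recurrence for its leading minors shows that the
  numbers \<open>s n\<close> of diagonals making it singular satisfy \<open>s (n + 1) + s n = 2 ^ n\<close>.
\<close>

section \<open>Boundary components as a kernel over the two-element field\<close>

text \<open>A set closed under \<open>R\<close> in both directions is a union of classes of the
  equivalence generated by \<open>R\<close>, and every subset of classes gives one. Counting
  components thus becomes counting solutions of equations over the two-element field.\<close>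

lemma pow2_num_components:
  assumes "finite V" "R \<subseteq> V \<times> V"
  shows "2 ^ num_components V R = card {S. S \<subseteq> V \<and> (\<forall>(p, q)\<in>R. p \<in> S \<longleftrightarrow> q \<in> S)}"
    (is "_ = card ?closed")
proof -
  define r where "r = (R \<union> R\<inverse>)\<^sup>*"
  \<comment> \<open>The closure is an equivalence on the whole type; since \<open>R\<close> stays
    inside \<open>V\<close>, the classes of points of \<open>V\<close> stay there too.\<close>
  have eq: "equiv UNIV r"
    unfolding r_def
    by (rule equivI) (auto simp: refl_on_def sym_rtrancl sym_Un_converse trans_rtrancl)
  have R_r: "R \<subseteq> r"
    by (auto simp: r_def)
  have sub: "V // r \<subseteq> UNIV // r"
    by (auto simp: quotient_def)
  have closed_r: "y \<in> S" if "(x, y) \<in> r" "x \<in> S" "\<forall>(p, q)\<in>R. p \<in> S \<longleftrightarrow> q \<in> S" for x y S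
    using that(1,2) unfolding r_def by (induction rule: rtrancl_induct) (use that(3) in auto)
  have V_closed: "\<forall>(p, q)\<in>R. p \<in> V \<longleftrightarrow> q \<in> V"
    using assms(2) by auto
  have class_V: "C \<subseteq> V" if "C \<in> V // r" for C
    using that closed_r[OF _ _ V_closed] by (auto simp: quotient_def)
  have class_step: "p \<in> C \<longleftrightarrow> q \<in> C" if "C \<in> V // r" "(p, q) \<in> R" for C p q
  proof -
    have "(p, q) \<in> r" using that R_r by auto
    moreover have "C \<in> UNIV // r" using that sub by auto
    ultimately show ?thesis
      using eq by (auto simp: equiv_def quotient_def dest: transD symD)
  qed
  have "bij_betw Union (Pow (V // r)) ?closed"
  proof (rule bij_betw_byWitness[where f' = "\<lambda>S. {C \<in> V // r. C \<subseteq> S}"])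
    show "\<forall>P\<in>Pow (V // r). {C \<in> V // r. C \<subseteq> \<Union>P} = P"
    proof safe
      fix P C assume P: "P \<subseteq> V // r" and C: "C \<in> V // r" "C \<subseteq> \<Union>P"
      obtain x where "x \<in> C"
        using C(1) eq by (auto simp: quotient_def equiv_def refl_on_def)
      then obtain C' where "C' \<in> P" "x \<in> C'" using C(2) by auto
      moreover have "C = C'"
        using quotient_disj[OF eq, of C C'] C(1) P \<open>C' \<in> P\<close> \<open>x \<in> C\<close> \<open>x \<in> C'\<close> sub by blast
      ultimately show "C \<in> P" by simp
    qed auto
    show "\<forall>S\<in>?closed. \<Union>{C \<in> V // r. C \<subseteq> S} = S"
    proof (intro ballI equalityI subsetI)
      fix S x assume S: "S \<in> ?closed" and x: "x \<in> S"
      have "r `` {x} \<subseteq> S" using closed_r S x by auto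
      moreover have "r `` {x} \<in> V // r" using S x by (auto simp: quotient_def)
      moreover have "x \<in> r `` {x}" by (simp add: r_def)
      ultimately show "x \<in> \<Union>{C \<in> V // r. C \<subseteq> S}" by blast
    qed auto
    show "Union ` Pow (V // r) \<subseteq> ?closed"
    proof safe
      fix P C x assume "P \<subseteq> V // r" "C \<in> P" "x \<in> C"
      then show "x \<in> V" using class_V by blast
    next
      fix P p q C assume "P \<subseteq> V // r" "(p, q) \<in> R" "C \<in> P" "p \<in> C"
      then show "q \<in> \<Union>P" using class_step[of C p q] by blast
    next
      fix P p q C assume "P \<subseteq> V // r" "(p, q) \<in> R" "C \<in> P" "q \<in> C"
      then show "p \<in> \<Union>P" using class_step[of C p q] by blast
    qed
    show "(\<lambda>S. {C \<in> V // r. C \<subseteq> S}) ` ?closed \<subseteq> Pow (V // r)"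
      by auto
  qed
  then have "card ?closed = card (Pow (V // r))"
    by (rule bij_betw_same_card[symmetric])
  also have "\<dots> = 2 ^ num_components V R"
    using assms(1) by (simp add: card_Pow num_components_def r_def quotient_def)
  finally show ?thesis by simp
qed

section \<open>Alternation of two letters in a word\<close>

lemma filter_two_letters_absent:
  "e \<notin> set u \<Longrightarrow> filter (\<lambda>x. x = e \<or> x = f) u = replicate (count_list u f) f"
  by (induction u) auto

text \<open>The two occurrences of \<open>e\<close> cut the circle into \<open>v\<close> and its
  complement, and \<open>f\<close> alternates with \<open>e\<close> exactly when one of its two
  occurrences lies in \<open>v\<close>. For \<open>f = e\<close> both sides are false.\<close>

lemma alternating_iff:
  assumes "e \<notin> set u" "e \<notin> set v" "e \<notin> set z"
    and "f \<noteq> e \<Longrightarrow> count_list (u @ v @ z) f \<in> {0, 2}"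
  shows "filter (\<lambda>x. x = e \<or> x = f) (u @ e # v @ e # z) \<in> {[e, f, e, f], [f, e, f, e]}
     \<longleftrightarrow> odd (count_list v f)"
proof (cases "f = e")
  case True
  have "filter (\<lambda>x. x = e) w = []" if "e \<notin> set w" for w
    using that by (auto simp: filter_empty_conv)
  with True show ?thesis
    using assms(1-3) by simp
next
  case False
  \<comment> \<open>These are all the ways to distribute zero or two occurrences of \<open>f\<close>
    over the three gaps left by \<open>e\<close>.\<close>
  have "k = 0 \<and> l = 0 \<and> m = 0 \<or> k = 2 \<and> l = 0 \<and> m = 0 \<or> k = 0 \<and> l = 2 \<and> m = 0 \<or>
      k = 0 \<and> l = 0 \<and> m = 2 \<or> k = 0 \<and> l = 1 \<and> m = 1 \<or> k = 1 \<and> l = 0 \<and> m = 1 \<or>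
      k = 1 \<and> l = 1 \<and> m = 0" if "k + (l + m) = 0 \<or> k + (l + m) = 2" for k l m :: nat
    using that by presburger
  from this[of "count_list u f" "count_list v f" "count_list z f"]
  consider "count_list u f = 0" "count_list v f = 0" "count_list z f = 0"
    | "count_list u f = 2" "count_list v f = 0" "count_list z f = 0"
    | "count_list u f = 0" "count_list v f = 2" "count_list z f = 0"
    | "count_list u f = 0" "count_list v f = 0" "count_list z f = 2"
    | "count_list u f = 0" "count_list v f = 1" "count_list z f = 1"
    | "count_list u f = 1" "count_list v f = 0" "count_list z f = 1"
    | "count_list u f = 1" "count_list v f = 1" "count_list z f = 0"
    using assms(4)[OF False] by auto
  moreover have "filter (\<lambda>x. x = e \<or> x = f) (u @ e # v @ e # z) =
      replicate (count_list u f) f @ e # replicate (count_list v f) f @ e # replicate (count_list z f) f"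
    using assms(1-3) by (simp add: filter_two_letters_absent)
  ultimately show ?thesis
    using False by cases (simp_all add: eval_nat_numeral)
qed

lemma length_filter_eq_sum_count:
  "finite X \<Longrightarrow> length (filter (\<lambda>h. fst h \<in> X) v) = (\<Sum>f\<in>X. count_list (map fst v) f)"
proof (induction v)
  case (Cons h v)
  have "(\<Sum>f\<in>X. count_list (map fst (h # v)) f)
      = (\<Sum>f\<in>X. (if fst h = f then 1 else 0) + count_list (map fst v) f)"
    by (intro sum.cong) auto
  then show ?case
    using Cons by (simp add: sum.distrib)
qed simp

text \<open>When the colour of the vertex circle flips at each end of an edge in \<open>X\<close>,
  this tells whether the gap before position \<open>k\<close> differs in colour from the starting
  gap.\<close>

definition prefix_parity :: "('e \<times> bool) list \<Rightarrow> 'e set \<Rightarrow> nat \<Rightarrow> bool" where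
  "prefix_parity d X k \<longleftrightarrow> odd (length (filter (\<lambda>h. fst h \<in> X) (take k d)))"

lemma prefix_parity_0 [simp]: "\<not> prefix_parity d X 0"
  by (simp add: prefix_parity_def)

lemma prefix_parity_Suc:
  "k < length d \<Longrightarrow> prefix_parity d X (Suc k) \<longleftrightarrow> prefix_parity d X k \<noteq> (fst (d ! k) \<in> X)"
  by (simp add: prefix_parity_def take_Suc_conv_app_nth)

text \<open>The kernel over the two-element field of the interlace matrix with ones on the diagonal
  at the twisted edges; in the equation of row \<open>e\<close> the diagonal term stands on the
  right.\<close>

definition interlace_kernel :: "'e ribbon_graph \<Rightarrow> 'e set set" where
  "interlace_kernel B =
     {X. X \<subseteq> edges B \<and>
        (\<forall>e\<in>edges B. odd (card {f \<in> X. interlaced B e f}) \<longleftrightarrow> e \<in> X \<and> e \<in> twisted B)}"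

text \<open>With \<open>d\<close> nonempty there is a first edge end to serve as base point, and the
  summand for isolated vertices vanishes.\<close>

locale one_disc =
  fixes B :: "'e ribbon_graph" and d :: "('e \<times> bool) list"
  assumes wf: "wf_ribbon_graph B" and discs_eq: "discs B = [d]" and nonempty: "d \<noteq> []"
begin

lemma distinct_d: "distinct d"
  and set_d: "set d = edges B \<times> UNIV"
  using wf by (auto simp: wf_ribbon_graph_def discs_eq)

lemma finite_edges: "finite (edges B)"
  by (simp add: edges_def)

lemma count_edge: "count_list (map fst d) e = (if e \<in> edges B then 2 else 0)"
proof -
  have "count_list (map fst d) e = length (filter (\<lambda>h. fst h = e) d)"
    by (induction d) auto
  also have "\<dots> = card (set (filter (\<lambda>h. fst h = e) d))"
    using distinct_d by (metis distinct_card distinct_filter)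
  also have "set (filter (\<lambda>h. fst h = e) d) = (if e \<in> edges B then {(e, False), (e, True)} else {})"
    using set_d by auto
  finally show ?thesis by auto
qed

text \<open>Every edge of \<open>X\<close> has two ends, so one full turn restores the colour; this
  makes a colouring consistent where the circle is cut open.\<close>

lemma prefix_parity_length: "X \<subseteq> edges B \<Longrightarrow> \<not> prefix_parity d X (length d)"
proof -
  assume X: "X \<subseteq> edges B"
  then have fin: "finite X" using finite_edges finite_subset by blast
  have "length (filter (\<lambda>h. fst h \<in> X) d) = (\<Sum>f\<in>X. 2)"
    unfolding length_filter_eq_sum_count[OF fin] using X by (intro sum.cong) (auto simp: count_edge)
  then show ?thesis
    by (simp add: prefix_parity_def)
qed

lemma edge_positions:
  assumes "e \<in> edges B"
  obtains i j b where "i < j" "j < length d" "d ! i = (e, b)" "d ! j = (e, \<not> b)"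
proof -
  have "(e, False) \<in> set d" "(e, True) \<in> set d" using assms set_d by auto
  then obtain i j where ij: "i < length d" "j < length d" "d ! i = (e, False)" "d ! j = (e, True)"
    by (auto simp: in_set_conv_nth)
  then have "i \<noteq> j" by auto
  then consider "i < j" | "j < i" by linarith
  then show ?thesis
  proof cases
    case 1 then show ?thesis using that[of i j False] ij by simp
  next
    case 2 then show ?thesis using that[of j i True] ij by simp
  qed
qed

text \<open>\<open>Suc i\<close> is just after the first end of \<open>e\<close> and
  \<open>j\<close> just before the second. The stretch between them contains one end of each edge
  interlaced with \<open>e\<close>, and none or both ends of every other edge.\<close>

lemma parity_between_ends:
  assumes X: "X \<subseteq> edges B"
    and ij: "i < j" "j < length d" "d ! i = (e, b)" "d ! j = (e, \<not> b)"
  shows "prefix_parity d X (Suc i) \<noteq> prefix_parity d X j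
    \<longleftrightarrow> odd (card {f \<in> X. interlaced B e f})"
proof -
  define u where "u = take i d"
  define v where "v = take (j - Suc i) (drop (Suc i) d)"
  define z where "z = drop (Suc j) d"
  have d1: "d = u @ (e, b) # drop (Suc i) d"
    using ij unfolding u_def by (metis id_take_nth_drop order.strict_trans)
  have "drop (Suc i) d = v @ drop j d"
    unfolding v_def using ij(1)
    by (metis Suc_leI append_take_drop_id drop_drop le_add_diff_inverse2)
  then have d2: "d = u @ (e, b) # v @ (e, \<not> b) # z"
    using d1 ij unfolding z_def by (metis Cons_nth_drop_Suc)
  have in_d: "(e, c) \<notin> set u \<union> set v \<union> set z" for c
    using distinct_d unfolding d2 by (cases "c = b") auto
  then have e_notin: "e \<notin> set (map fst u)" "e \<notin> set (map fst v)" "e \<notin> set (map fst z)"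
    by auto
  have inter: "interlaced B e f \<longleftrightarrow> odd (count_list (map fst v) f)" for f
  proof -
    have "count_list (map fst u @ map fst v @ map fst z) f \<in> {0, 2}" if "f \<noteq> e"
    proof -
      have "count_list (map fst u @ map fst v @ map fst z) f = count_list (map fst d) f"
        unfolding d2 using that by simp
      then show ?thesis by (simp add: count_edge)
    qed
    from alternating_iff[OF e_notin this] show ?thesis
      unfolding interlaced_def discs_eq using d2 by simp
  qed
  have fin: "finite X" using X finite_edges finite_subset by blast
  have "take j d = take (Suc i) d @ v"
    unfolding v_def using ij(1) by (metis Suc_leI le_add_diff_inverse take_add)
  then have "prefix_parity d X (Suc i) \<noteq> prefix_parity d X j
      \<longleftrightarrow> odd (length (filter (\<lambda>h. fst h \<in> X) v))"
    by (auto simp: prefix_parity_def)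
  \<comment> \<open>Modulo two, only the edges with an odd number of ends in \<open>v\<close>
    contribute.\<close>
  also have "\<dots> \<longleftrightarrow> odd (card {f \<in> X. odd (count_list (map fst v) f)})"
    using fin by (simp add: length_filter_eq_sum_count even_sum_iff)
  finally show ?thesis
    by (simp add: inter)
qed

text \<open>
  Membership in a union of boundary components is a two-colouring of the vertex circle that is
  constant on the vertex arcs.  It is determined by its value \<open>c\<close> before the first edge
  end and by the set \<open>X\<close> of edges whose attaching arcs change the colour.
\<close>

definition colouring :: "bool \<Rightarrow> 'e set \<Rightarrow> (('e \<times> bool) \<times> bool) set" where
  "colouring c X = {(d ! i, s) | i s. i < length d \<and> c \<noteq> prefix_parity d X (i + of_bool s)}"

definition boundary_unions :: "(('e \<times> bool) \<times> bool) set set" where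
  "boundary_unions =
     {S. S \<subseteq> boundary_points B \<and> (\<forall>(p, q)\<in>vertex_arcs B \<union> ribbon_sides B. p \<in> S \<longleftrightarrow> q \<in> S)}"

text \<open>Distinctness of \<open>d\<close> makes the position of an edge end unique. The offset
  \<open>of_bool s\<close> is 0 for the point before the attaching arc and 1 for the point after
  it.\<close>

lemma in_colouring [simp]:
  "i < length d \<Longrightarrow> (d ! i, s) \<in> colouring c X \<longleftrightarrow> c \<noteq> prefix_parity d X (i + of_bool s)"
  using distinct_d by (auto simp: colouring_def nth_eq_iff_index_eq)

lemma colouring_subset: "colouring c X \<subseteq> boundary_points B"
  using set_d nth_mem by (fastforce simp: colouring_def boundary_points_def)

lemma boundary_unions_iff:
  "S \<in> boundary_unions \<longleftrightarrow> S \<subseteq> boundary_points B \<and>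
     (\<forall>i<length d. (d ! i, True) \<in> S \<longleftrightarrow> (d ! (Suc i mod length d), False) \<in> S) \<and>
     (\<forall>e\<in>edges B. \<forall>b s. ((e, b), s) \<in> S \<longleftrightarrow>
        ((e, \<not> b), if e \<in> twisted B then s else \<not> s) \<in> S)"
proof -
  have "(\<forall>(p, q)\<in>vertex_arcs B. p \<in> S \<longleftrightarrow> q \<in> S) \<longleftrightarrow>
      (\<forall>i<length d. (d ! i, True) \<in> S \<longleftrightarrow> (d ! (Suc i mod length d), False) \<in> S)"
    unfolding vertex_arcs_def discs_eq list.set singleton_iff by blast
  moreover have "(\<forall>(p, q)\<in>ribbon_sides B. p \<in> S \<longleftrightarrow> q \<in> S) \<longleftrightarrow>
      (\<forall>e\<in>edges B. \<forall>b s. ((e, b), s) \<in> S \<longleftrightarrow>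
        ((e, \<not> b), if e \<in> twisted B then s else \<not> s) \<in> S)"
    unfolding ribbon_sides_def by blast
  ultimately show ?thesis
    unfolding boundary_unions_def ball_Un by simp
qed

text \<open>Take \<open>c\<close> to be the colour of the first point and \<open>X\<close> the edges
  whose attaching arcs have end points of different colours. Going round the circle, an attaching
  arc changes the colour as \<open>X\<close> prescribes and a vertex arc keeps it, so
  \<open>S\<close> is recovered.\<close>

lemma colouring_of_boundary_union:
  assumes S: "S \<in> boundary_unions"
  obtains c X where "X \<subseteq> edges B" "S = colouring c X"
proof -
  define c where "c = ((d ! 0, False) \<in> S)"
  define X where "X = {e \<in> edges B. (((e, False), False) \<in> S) \<noteq> (((e, False), True) \<in> S)}"
  have arc: "(d ! i, True) \<in> S \<longleftrightarrow> (d ! (Suc i mod length d), False) \<in> S" if "i < length d" for i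
    using S that by (simp add: boundary_unions_iff)
  have side: "((e, b), s) \<in> S \<longleftrightarrow> ((e, \<not> b), if e \<in> twisted B then s else \<not> s) \<in> S"
    if "e \<in> edges B" for e b s
    using S that unfolding boundary_unions_iff by blast
  \<comment> \<open>\<open>X\<close> is read off at the end \<open>(e, False)\<close>. The ribbon
    sides match the two end points there with those at the other end, in one order or the other, so
    both ends agree.\<close>
  have X_iff: "fst h \<in> X \<longleftrightarrow> ((h, False) \<in> S) \<noteq> ((h, True) \<in> S)" if "h \<in> set d" for h
  proof -
    obtain e b where h: "h = (e, b)" by fastforce
    then have e: "e \<in> edges B" using that set_d by auto
    show ?thesis
      using side[OF e, of False False] side[OF e, of False True] e h
      by (cases b) (auto simp: X_def split: if_splits)
  qed
  have value_True: "(d ! i, True) \<in> S \<longleftrightarrow> c \<noteq> prefix_parity d X (Suc i)"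
    if "i < length d" "(d ! i, False) \<in> S \<longleftrightarrow> c \<noteq> prefix_parity d X i" for i
    using that X_iff[of "d ! i"] by (auto simp: prefix_parity_Suc)
  have value_False: "(d ! i, False) \<in> S \<longleftrightarrow> c \<noteq> prefix_parity d X i" if "i < length d" for i
    using that
  proof (induction i)
    case 0
    then show ?case by (simp add: c_def)
  next
    case (Suc i)
    then show ?case using value_True[of i] arc[of i] by simp
  qed
  have "S = colouring c X"
  proof (rule set_eqI)
    fix p
    show "p \<in> S \<longleftrightarrow> p \<in> colouring c X"
    proof (cases "p \<in> boundary_points B")
      case True
      then have "fst p \<in> set d"
        unfolding set_d by (auto simp: boundary_points_def)
      then obtain i where "i < length d" "d ! i = fst p"
        unfolding in_set_conv_nth by blast
      then obtain s where "p = (d ! i, s)" "i < length d"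
        by (metis prod.collapse)
      then show ?thesis
        using value_False value_True by (cases s) auto
    next
      case False
      then show ?thesis using S colouring_subset by (auto simp: boundary_unions_iff)
    qed
  qed
  moreover have "X \<subseteq> edges B" by (auto simp: X_def)
  ultimately show ?thesis using that by blast
qed

text \<open>The vertex arcs impose nothing. With the ends of \<open>e\<close> at
  \<open>i < j\<close>, an untwisted ribbon asks for equal parities at \<open>Suc i\<close> and
  \<open>j\<close>, a twisted one for equal parities at \<open>i\<close> and \<open>j\<close>. By
  \<open>parity_between_ends\<close> this is the kernel equation of row \<open>e\<close>.\<close>

lemma colouring_boundary_union_iff:
  assumes X: "X \<subseteq> edges B"
  shows "colouring c X \<in> boundary_unions \<longleftrightarrow> X \<in> interlace_kernel B"
proof -
  have arc: "(d ! i, True) \<in> colouring c X \<longleftrightarrow> (d ! (Suc i mod length d), False) \<in> colouring c X"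
    if i: "i < length d" for i
  proof (cases "Suc i = length d")
    case True
    then show ?thesis using i prefix_parity_length[OF X] nonempty by simp
  next
    case False
    then show ?thesis using i by simp
  qed
  have side: "(\<forall>b s. ((e, b), s) \<in> colouring c X \<longleftrightarrow>
        ((e, \<not> b), if e \<in> twisted B then s else \<not> s) \<in> colouring c X) \<longleftrightarrow>
      (odd (card {f \<in> X. interlaced B e f}) \<longleftrightarrow> e \<in> X \<and> e \<in> twisted B)"
    if e: "e \<in> edges B" for e
  proof -
    obtain i j b where ij: "i < j" "j < length d" "d ! i = (e, b)" "d ! j = (e, \<not> b)"
      using edge_positions[OF e] .
    have mem_i: "((e, b), s) \<in> colouring c X \<longleftrightarrow> c \<noteq> prefix_parity d X (i + of_bool s)" for s
      using in_colouring[of i s c X] ij by simp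
    have mem_j: "((e, \<not> b), s) \<in> colouring c X \<longleftrightarrow> c \<noteq> prefix_parity d X (j + of_bool s)" for s
      using in_colouring[of j s c X] ij by simp
    have Suc_i: "prefix_parity d X (Suc i) \<longleftrightarrow> prefix_parity d X i \<noteq> (e \<in> X)"
      using prefix_parity_Suc[of i d X] ij by simp
    have Suc_j: "prefix_parity d X (Suc j) \<longleftrightarrow> prefix_parity d X j \<noteq> (e \<in> X)"
      using prefix_parity_Suc[of j d X] ij by simp
    \<comment> \<open>The ends are listed starting from \<open>b\<close>, the one met first, so that
      the positions \<open>i\<close> and \<open>j\<close> can be inserted.\<close>
    have all_ends: "(\<forall>b s. P b s) \<longleftrightarrow> P b True \<and> P b False \<and> P (\<not> b) True \<and> P (\<not> b) False"
      for P :: "bool \<Rightarrow> bool \<Rightarrow> bool"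
      by (cases b) (auto simp: all_bool_eq)
    show ?thesis
      unfolding parity_between_ends[OF X ij, symmetric]
      by (subst all_ends, cases "e \<in> twisted B"; simp add: mem_i mem_j Suc_i Suc_j; blast)
  qed
  show ?thesis
    unfolding boundary_unions_iff interlace_kernel_def
    using colouring_subset arc side X by auto
qed

text \<open>The first point shows \<open>c\<close>, and \<open>e\<close> lies in \<open>X\<close>
  exactly when the colours on the two sides of an end of \<open>e\<close> differ.\<close>

lemma colouring_inject:
  assumes "colouring c X = colouring c' X'" "X \<subseteq> edges B" "X' \<subseteq> edges B"
  shows "c = c' \<and> X = X'"
proof
  have "(d ! 0, False) \<in> colouring c X \<longleftrightarrow> (d ! 0, False) \<in> colouring c' X'"
    using assms(1) by simp
  then show "c = c'" using nonempty by simp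
  have "e \<in> X \<longleftrightarrow> e \<in> X'" if e: "e \<in> edges B" for e
  proof -
    obtain i j b where ij: "i < j" "j < length d" "d ! i = (e, b)" "d ! j = (e, \<not> b)"
      using edge_positions[OF e] .
    have "c \<noteq> prefix_parity d X (i + of_bool s) \<longleftrightarrow> c' \<noteq> prefix_parity d X' (i + of_bool s)" for s
      using assms(1) in_colouring[of i s c X] in_colouring[of i s c' X'] ij by simp
    from this[of False] this[of True] show ?thesis
      using ij \<open>c = c'\<close> prefix_parity_Suc[of i d X] prefix_parity_Suc[of i d X'] by auto
  qed
  then show "X = X'" using assms(2,3) by blast
qed

text \<open>Unions of boundary components correspond to pairs of a base colour and a kernel vector;
  the factor 2 counts the base colours.\<close>

lemma pow2_num_boundary_components:
  "2 ^ num_boundary_components B = 2 * card (interlace_kernel B)"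
proof -
  have sub: "vertex_arcs B \<union> ribbon_sides B \<subseteq> boundary_points B \<times> boundary_points B"
  proof -
    have in_points: "(d ! i, s) \<in> boundary_points B" if "i < length d" for i s
      using that set_d nth_mem by (auto simp: boundary_points_def)
    have "vertex_arcs B \<subseteq> boundary_points B \<times> boundary_points B"
      unfolding vertex_arcs_def discs_eq using in_points nonempty by auto
    moreover have "ribbon_sides B \<subseteq> boundary_points B \<times> boundary_points B"
      unfolding ribbon_sides_def boundary_points_def by auto
    ultimately show ?thesis by blast
  qed
  have "2 ^ num_boundary_components B = card boundary_unions"
    using pow2_num_components[OF _ sub] finite_edges nonempty
    by (simp add: num_boundary_components_def discs_eq boundary_unions_def boundary_points_def)
  also have "boundary_unions = (\<lambda>(c, X). colouring c X) ` (UNIV \<times> interlace_kernel B)"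
  proof (intro equalityI subsetI)
    fix S assume S: "S \<in> boundary_unions"
    then obtain c X where "X \<subseteq> edges B" "S = colouring c X"
      by (rule colouring_of_boundary_union)
    then show "S \<in> (\<lambda>(c, X). colouring c X) ` (UNIV \<times> interlace_kernel B)"
      using S colouring_boundary_union_iff by auto
  next
    fix S assume "S \<in> (\<lambda>(c, X). colouring c X) ` (UNIV \<times> interlace_kernel B)"
    then show "S \<in> boundary_unions"
      using colouring_boundary_union_iff by (auto simp: interlace_kernel_def)
  qed
  also have "card \<dots> = card (UNIV \<times> interlace_kernel B :: (bool \<times> 'e set) set)"
  proof (intro card_image inj_onI)
    fix p q assume "p \<in> UNIV \<times> interlace_kernel B" "q \<in> UNIV \<times> interlace_kernel B"
      "(case p of (c, X) \<Rightarrow> colouring c X) = (case q of (c, X) \<Rightarrow> colouring c X)"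
    then show "p = q"
      using colouring_inject[of "fst p" "snd p" "fst q" "snd q"]
      by (simp add: interlace_kernel_def case_prod_beta prod_eq_iff mem_Times_iff)
  qed
  finally show ?thesis by (simp add: card_cartesian_product)
qed

lemma num_conn_components_eq_1: "num_conn_components B = 1"
proof -
  have "{..<length (discs B)} = {0}"
    by (auto simp: discs_eq)
  then show ?thesis
    unfolding num_conn_components_def num_components_def quotient_def by simp
qed

lemma euler_genus_eq:
  "euler_genus B = int (card (edges B)) + 1 - int (num_boundary_components B)"
  by (simp add: euler_genus_def num_conn_components_eq_1 num_vertices_def num_edges_def discs_eq)

end


section \<open>The path\<close>

text \<open>
  The parity of the determinant of the leading principal submatrix of order \<open>i - 1\<close> of
  the adjacency matrix of the path, with ones on the diagonal at the positions in \<open>T\<close>.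
\<close>

fun continuant :: "nat set \<Rightarrow> nat \<Rightarrow> bool" where
  "continuant T 0 = False"
| "continuant T (Suc 0) = True"
| "continuant T (Suc (Suc i)) = (continuant T i \<noteq> (Suc i \<in> T \<and> continuant T (Suc i)))"

lemma continuant_cong:
  "(\<And>k. 1 \<le> k \<Longrightarrow> k < i \<Longrightarrow> k \<in> T \<longleftrightarrow> k \<in> T') \<Longrightarrow> continuant T i = continuant T' i"
  by (induction T i rule: continuant.induct) auto

text \<open>Where a value is false, the recurrence makes its two neighbours equal, so two
  consecutive false values would propagate down to the start.\<close>

lemma continuant_consecutive: "continuant T i \<or> continuant T (Suc i)"
  by (induction i) auto

text \<open>The analogue of \<open>interlace_kernel\<close> with the edges of the bouquet renamed as
  the vertices of the path and \<open>T\<close> as the twisted ones.\<close>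

definition path_kernel :: "nat \<Rightarrow> nat set \<Rightarrow> nat set set" where
  "path_kernel n T = {X. X \<subseteq> {1..n} \<and>
     (\<forall>i\<in>{1..n}. odd (card {j \<in> X. j = i + 1 \<or> i = j + 1}) \<longleftrightarrow> i \<in> X \<and> i \<in> T)}"

lemma odd_card_neighbours:
  "odd (card {j \<in> X. j = Suc (Suc i) \<or> i = j}) \<longleftrightarrow> (Suc (Suc i) \<in> X) \<noteq> (i \<in> X)"
proof -
  have "{j \<in> X. j = Suc (Suc i) \<or> i = j} =
      (if Suc (Suc i) \<in> X then {Suc (Suc i)} else {}) \<union> (if i \<in> X then {i} else {})"
    by auto
  then show ?thesis by auto
qed

text \<open>Each row determines the next entry of a kernel vector from the two before it, so the
  vector is zero or the sequence of continuants. The last row asks the entry at \<open>Suc n\<close>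
  to vanish.\<close>

lemma card_path_kernel:
  assumes "1 \<le> n"
  shows "card (path_kernel n T) = (if continuant T (Suc n) then 1 else 2)"
proof -
  \<comment> \<open>Rows are renumbered from 0; the positions 0 and \<open>Suc n\<close> lie outside
    \<open>X\<close> and supply the zero boundary values.\<close>
  have rec: "X \<in> path_kernel n T \<longleftrightarrow> X \<subseteq> {1..n} \<and>
      (\<forall>i<n. (Suc (Suc i) \<in> X) = ((i \<in> X) \<noteq> (Suc i \<in> X \<and> Suc i \<in> T)))" for X
  proof -
    have "(\<forall>i\<in>{1..n}. P i) \<longleftrightarrow> (\<forall>i<n. P (Suc i))" for P
      by (metis One_nat_def atLeastAtMost_iff le_simps(3) not0_implies_Suc not_less_eq_eq zero_le)
    then show ?thesis
      unfolding path_kernel_def by (auto simp: odd_card_neighbours)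
  qed
  have from_first: "(i \<in> X) = (1 \<in> X \<and> continuant T i)" if "X \<in> path_kernel n T" "i \<le> Suc n" for X i
    using that(2)
  proof (induction i rule: induct_nat_012)
    case 0
    then show ?case using that(1) by (auto simp: rec)
  next
    case (ge2 i)
    then show ?case using that(1) by (auto simp: rec)
  qed simp
  define Y where "Y = {i \<in> {1..n}. continuant T i}"
  have only: "X = {} \<or> X = Y \<and> \<not> continuant T (Suc n)" if X: "X \<in> path_kernel n T" for X
  proof -
    have sub: "X \<subseteq> {1..n}" using X by (simp add: path_kernel_def)
    have X_iff: "i \<in> X \<longleftrightarrow> i \<in> {1..n} \<and> 1 \<in> X \<and> continuant T i" for i
      using from_first[OF X, of i] sub by (cases "i \<in> {1..n}") auto
    show ?thesis
    proof (cases "1 \<in> X")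
      case True
      then have "\<not> continuant T (Suc n)"
        using from_first[OF X, of "Suc n"] sub by auto
      moreover have "X = Y"
        using True by (intro set_eqI, subst X_iff) (simp add: Y_def)
      ultimately show ?thesis by simp
    next
      case False
      then have "i \<notin> X" for i by (subst X_iff) simp
      then show ?thesis by blast
    qed
  qed
  have Y: "Y \<in> path_kernel n T" if "\<not> continuant T (Suc n)"
    unfolding rec
  proof (intro conjI allI impI)
    fix i assume i: "i < n"
    have mem: "j \<in> Y \<longleftrightarrow> continuant T j" if "j \<le> Suc n" for j
      using that \<open>\<not> continuant T (Suc n)\<close> by (cases j) (auto simp: Y_def le_Suc_eq)
    show "(Suc (Suc i) \<in> Y) = ((i \<in> Y) \<noteq> (Suc i \<in> Y \<and> Suc i \<in> T))"
      using i by (auto simp: mem)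
  qed (auto simp: Y_def)
  have "{} \<in> path_kernel n T" by (simp add: path_kernel_def)
  then have "path_kernel n T = (if continuant T (Suc n) then {{}} else {{}, Y})"
    using only Y by auto
  \<comment> \<open>This separates \<open>Y\<close> from the empty set, so the kernel really has two
    elements.\<close>
  moreover have "1 \<in> Y" using assms by (simp add: Y_def)
  ultimately show ?thesis by (auto simp: card_insert_if)
qed

section \<open>Counting the singular diagonals\<close>

definition singular_sets :: "nat \<Rightarrow> nat set set" where
  "singular_sets n = {T \<in> Pow {1..n}. \<not> continuant T (Suc n)}"

text \<open>
  If the leading minor of order \<open>n\<close> is nonzero, then exactly one choice of the last diagonal
  entry gives a singular matrix of order \<open>n + 1\<close>; otherwise none does.
\<close>

lemma card_singular_sets_Suc: "card (singular_sets (Suc n)) + card (singular_sets n) = 2 ^ n"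
proof -
  \<comment> \<open>When \<open>continuant U (Suc n)\<close> holds, the next continuant vanishes
    precisely if membership of \<open>Suc n\<close> agrees with
    \<open>continuant U n\<close>.\<close>
  define ext where "ext U = (if continuant U n then insert (Suc n) U else U)" for U
  have cont_ext: "continuant (ext U) i = continuant U i" if "i \<le> Suc n" for U i
    using that by (intro continuant_cong) (auto simp: ext_def)
  have "bij_betw ext (Pow {1..n} - singular_sets n) (singular_sets (Suc n))"
  proof (rule bij_betw_byWitness[where f' = "\<lambda>T. T \<inter> {1..n}"])
    show "\<forall>U\<in>Pow {1..n} - singular_sets n. ext U \<inter> {1..n} = U"
      by (auto simp: ext_def)
    have restrict: "continuant (T \<inter> {1..n}) i = continuant T i" if "i \<le> Suc n" for T i
      using that by (intro continuant_cong) auto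
    \<comment> \<open>If \<open>continuant T (Suc n)\<close> were false, the recurrence would make
      \<open>continuant T n\<close> false too, against
      \<open>continuant_consecutive\<close>.\<close>
    have regular: "continuant T (Suc n) \<and> (Suc n \<in> T \<longleftrightarrow> continuant T n)"
      if "T \<in> singular_sets (Suc n)" for T
      using that continuant_consecutive[of T n] by (auto simp: singular_sets_def)
    show "\<forall>T\<in>singular_sets (Suc n). ext (T \<inter> {1..n}) = T"
    proof
      fix T assume T: "T \<in> singular_sets (Suc n)"
      then have "T \<subseteq> insert (Suc n) {1..n}" by (auto simp: singular_sets_def)
      then show "ext (T \<inter> {1..n}) = T"
        using regular[OF T] restrict[of n T] unfolding ext_def by auto
    qed
    show "ext ` (Pow {1..n} - singular_sets n) \<subseteq> singular_sets (Suc n)"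
    proof clarify
      fix U assume U: "U \<subseteq> {1..n}" "U \<notin> singular_sets n"
      then have "continuant U (Suc n)" by (simp add: singular_sets_def)
      moreover have "ext U \<subseteq> {1..Suc n}" "Suc n \<in> ext U \<longleftrightarrow> continuant U n"
        using U(1) by (auto simp: ext_def)
      ultimately show "ext U \<in> singular_sets (Suc n)"
        by (simp add: singular_sets_def cont_ext)
    qed
    show "(\<lambda>T. T \<inter> {1..n}) ` singular_sets (Suc n) \<subseteq> Pow {1..n} - singular_sets n"
    proof clarify
      fix T assume T: "T \<in> singular_sets (Suc n)"
      show "T \<inter> {1..n} \<in> Pow {1..n} - singular_sets n"
        using regular[OF T] restrict[of "Suc n" T] by (simp add: singular_sets_def)
    qed
  qed
  then have "card (singular_sets (Suc n)) = card (Pow {1..n} - singular_sets n)"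
    by (simp add: bij_betw_same_card)
  also have "\<dots> = 2 ^ n - card (singular_sets n)"
    by (subst card_Diff_subset) (auto simp: singular_sets_def card_Pow)
  moreover have "card (singular_sets n) \<le> card (Pow {1..n})"
    by (intro card_mono) (auto simp: singular_sets_def)
  ultimately show ?thesis by (simp add: card_Pow)
qed

text \<open>This solves the preceding recurrence from the value 0 at \<open>n = 0\<close>, where the
  empty determinant is one; rationals permit the alternating sign.\<close>

lemma card_singular_sets: "3 * (of_nat (card (singular_sets n)) :: rat) = 2 ^ n - (- 1) ^ n"
proof (induction n)
  case 0
  have "singular_sets 0 = {}" by (auto simp: singular_sets_def)
  then show ?case by simp
next
  case (Suc n)
  have "(of_nat (card (singular_sets (Suc n)) + card (singular_sets n)) :: rat) = 2 ^ n"
    unfolding card_singular_sets_Suc by simp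
  then have "(of_nat (card (singular_sets (Suc n))) :: rat) = 2 ^ n - of_nat (card (singular_sets n))"
    by simp
  then show ?case using Suc by (simp add: algebra_simps)
qed

section \<open>Bouquets representing the path\<close>

text \<open>An isomorphism of digraphs maps vertices and arcs separately. As an arc here is the pair
  of its end points, the vertex map \<open>g\<close> determines the arc map and carries
  interlacement to adjacency.\<close>

lemma represents_pathE:
  assumes "represents B (path_graph n)" "1 \<le> n"
  obtains d g where "one_disc B d" "bij_betw g (edges B) {1..n}"
    "\<And>a b. a \<in> edges B \<Longrightarrow> b \<in> edges B \<Longrightarrow> interlaced B a b \<longleftrightarrow> g b = g a + 1 \<or> g a = g b + 1"
proof -
  let ?M = "with_proj (intersection_graph B)" and ?N = "with_proj (path_graph n)"
  obtain f where f: "pre_digraph.digraph_isomorphism ?M f" "?N = app_iso f ?M"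
    using assms(1) by (auto simp: represents_def digraph_iso_def)
  define g where "g = iso_verts f"
  note iso = f(1)[unfolded pre_digraph.digraph_isomorphism_def]
  have verts: "edges B = pverts (intersection_graph B)" "g ` edges B = {1..n}"
    using arg_cong[OF f(2), of verts] by (simp_all add: g_def intersection_graph_def path_graph_def)
  have inj: "inj_on g (edges B)"
    using iso by (simp add: g_def intersection_graph_def)
  \<comment> \<open>The new tail and head maps are components of \<open>f\<close>; comparing them
    with those of the path identifies them as the projections.\<close>
  have tail: "fst = iso_tail f" and head: "snd = iso_head f"
    using arg_cong[OF f(2), of tail] arg_cong[OF f(2), of head] by simp_all
  have arcs: "parcs (path_graph n) = iso_arcs f ` parcs (intersection_graph B)"
    using arg_cong[OF f(2), of arcs] by simp
  have map_arc: "iso_arcs f a = (g (fst a), g (snd a))" if "a \<in> parcs (intersection_graph B)" for a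
    using iso that by (simp add: g_def prod_eq_iff flip: tail head)
  have arc_verts: "fst a \<in> edges B \<and> snd a \<in> edges B" if "a \<in> parcs (intersection_graph B)" for a
    using iso that by (cases a) (auto simp: wf_digraph_def verts(1))
  have inter: "interlaced B a b \<longleftrightarrow> g b = g a + 1 \<or> g a = g b + 1"
    if ab: "a \<in> edges B" "b \<in> edges B" for a b
  proof -
    have "interlaced B a b \<longleftrightarrow> (a, b) \<in> parcs (intersection_graph B)"
      by (simp add: intersection_graph_def)
    also have "\<dots> \<longleftrightarrow> (g a, g b) \<in> parcs (path_graph n)"
    proof
      assume "(a, b) \<in> parcs (intersection_graph B)"
      then show "(g a, g b) \<in> parcs (path_graph n)"
        unfolding arcs using map_arc by force
    next
      assume "(g a, g b) \<in> parcs (path_graph n)"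
      then obtain p where p: "p \<in> parcs (intersection_graph B)" "(g a, g b) = iso_arcs f p"
        unfolding arcs by blast
      then have "g a = g (fst p)" "g b = g (snd p)" using map_arc by auto
      then have "a = fst p" "b = snd p"
        using inj ab arc_verts[OF p(1)] by (auto dest: inj_onD)
      then show "(a, b) \<in> parcs (intersection_graph B)" using p(1) by simp
    qed
    also have "\<dots> \<longleftrightarrow> g b = g a + 1 \<or> g a = g b + 1"
    proof -
      have "g a \<in> {1..n}" "g b \<in> {1..n}" using ab verts(2) by blast+
      then show ?thesis by (auto simp: path_graph_def)
    qed
    finally show ?thesis .
  qed
  have bq: "wf_ribbon_graph B" "length (discs B) = 1"
    using assms(1) by (simp_all add: represents_def bouquet_def num_vertices_def)
  then obtain d where d: "discs B = [d]"
    by (auto simp: length_Suc_conv)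
  have "d \<noteq> []"
    using verts(2) assms(2) by (auto simp: edges_def d)
  then have "one_disc B d" using bq d by (simp add: one_disc_def)
  then show ?thesis
    using that[of d g] inj verts(2) inter by (simp add: bij_betw_def)
qed

text \<open>Renaming along \<open>g\<close> matches the kernel equations row by row, so
  \<open>image g\<close> is a bijection between the two kernels.\<close>

lemma card_interlace_kernel_path:
  assumes g: "bij_betw g (edges B) {1..n}"
    and inter: "\<And>a b. a \<in> edges B \<Longrightarrow> b \<in> edges B \<Longrightarrow>
      interlaced B a b \<longleftrightarrow> g b = g a + 1 \<or> g a = g b + 1"
    and tw: "twisted B \<subseteq> edges B"
  shows "card (interlace_kernel B) = card (path_kernel n (g ` twisted B))"
proof -
  have inj: "inj_on g (edges B)" and im: "g ` edges B = {1..n}"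
    using g by (auto simp: bij_betw_def)
  have kernel_iff: "X \<in> interlace_kernel B \<longleftrightarrow> g ` X \<in> path_kernel n (g ` twisted B)"
    if X: "X \<subseteq> edges B" for X
  proof -
    have cond: "(odd (card {f \<in> X. interlaced B e f}) \<longleftrightarrow> e \<in> X \<and> e \<in> twisted B) \<longleftrightarrow>
      (odd (card {j \<in> g ` X. j = g e + 1 \<or> g e = j + 1}) \<longleftrightarrow> g e \<in> g ` X \<and> g e \<in> g ` twisted B)"
      if e: "e \<in> edges B" for e
    proof -
      have "{j \<in> g ` X. j = g e + 1 \<or> g e = j + 1} = g ` {f \<in> X. interlaced B e f}"
        using inter[OF e] X by auto
      moreover have "inj_on g {f \<in> X. interlaced B e f}"
        using inj by (rule inj_on_subset) (use X in auto)
      ultimately show ?thesis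
        using inj_on_image_mem_iff[OF inj e X] inj_on_image_mem_iff[OF inj e tw]
        by (simp add: card_image)
    qed
    have "g ` X \<subseteq> {1..n}" using X im by auto
    then show ?thesis
      unfolding interlace_kernel_def path_kernel_def im[symmetric] using X cond by auto
  qed
  have "image g ` interlace_kernel B = path_kernel n (g ` twisted B)"
  proof (intro equalityI subsetI)
    fix Y assume Y: "Y \<in> path_kernel n (g ` twisted B)"
    then have "Y \<subseteq> g ` edges B" by (simp add: im path_kernel_def)
    then obtain X where "X \<subseteq> edges B" "Y = g ` X" by (auto simp: subset_image_iff)
    then show "Y \<in> image g ` interlace_kernel B"
      using Y kernel_iff by auto
  next
    fix Y assume "Y \<in> image g ` interlace_kernel B"
    then show "Y \<in> path_kernel n (g ` twisted B)"
      using kernel_iff by (auto simp: interlace_kernel_def)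
  qed
  moreover have "inj_on (image g) (interlace_kernel B)"
    using inj_on_image_Pow[OF inj] by (rule inj_on_subset) (auto simp: interlace_kernel_def)
  ultimately show ?thesis by (metis card_image)
qed

text \<open>As \<open>A\<close> varies, the twisted set runs once through all sets of edges, so the
  sum is over all diagonals \<open>T\<close>. Singular ones contribute genus \<open>n - 1\<close>
  and the others \<open>n\<close>, whatever bouquet was chosen.\<close>

lemma petrial_polynomial_path:
  assumes "represents B (path_graph n)" "1 \<le> n"
  shows "petrial_polynomial B =
    monom (of_nat (card (singular_sets n))) (n - 1) + monom (2 ^ n - of_nat (card (singular_sets n))) n"
proof -
  obtain d g where B: "one_disc B d" and g: "bij_betw g (edges B) {1..n}"
    and inter: "\<And>a b. a \<in> edges B \<Longrightarrow> b \<in> edges B \<Longrightarrow>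
      interlaced B a b \<longleftrightarrow> g b = g a + 1 \<or> g a = g b + 1"
    by (rule represents_pathE[OF assms]) (rule that; assumption)
  have tw: "twisted B \<subseteq> edges B"
    using B by (simp add: one_disc_def wf_ribbon_graph_def)
  define twist where "twist A = (twisted B - A) \<union> (A - twisted B)" for A
  have genus: "euler_genus (partial_petrial B A)
      = int (if continuant (g ` twist A) (Suc n) then n else n - 1)" if A: "A \<subseteq> edges B" for A
  proof -
    let ?B = "partial_petrial B A"
    have [simp]: "discs ?B = discs B" "twisted ?B = twist A"
      by (simp_all add: partial_petrial_def twist_def)
    have [simp]: "edges ?B = edges B" "interlaced ?B = interlaced B"
      by (simp_all add: edges_def interlaced_def fun_eq_iff)
    have sub: "twist A \<subseteq> edges B" using A tw by (auto simp: twist_def)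
    have "one_disc ?B d"
      using B sub by (auto simp: one_disc_def wf_ribbon_graph_def)
    then interpret one_disc ?B d .
    have "card (interlace_kernel ?B) = (if continuant (g ` twist A) (Suc n) then 1 else 2)"
      using card_interlace_kernel_path[of g ?B n] g inter sub card_path_kernel[OF assms(2)] by simp
    then have "2 ^ num_boundary_components ?B
        = (2::nat) ^ (if continuant (g ` twist A) (Suc n) then 1 else 2)"
      using pow2_num_boundary_components by simp
    then have "num_boundary_components ?B = (if continuant (g ` twist A) (Suc n) then 1 else 2)"
      by (simp only: power_inject_exp)
    moreover have "card (edges B) = n"
      using bij_betw_same_card[OF g] by simp
    ultimately show ?thesis
      using assms(2) by (simp add: euler_genus_eq)
  qed
  \<comment> \<open>Symmetric difference with a fixed set is its own inverse.\<close>
  have "bij_betw twist (Pow (edges B)) (Pow (edges B))"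
    by (rule bij_betw_byWitness[where f' = twist]) (use tw in \<open>auto simp: twist_def\<close>)
  then have bij: "bij_betw (image g \<circ> twist) (Pow (edges B)) (Pow {1..n})"
    using bij_betw_Pow[OF g] by (rule bij_betw_trans)
  have "petrial_polynomial B =
      (\<Sum>A\<in>Pow (edges B). monom 1 (if continuant ((image g \<circ> twist) A) (Suc n) then n else n - 1))"
    unfolding petrial_polynomial_def by (intro sum.cong) (auto simp: genus)
  also have "\<dots> = (\<Sum>T\<in>Pow {1..n}. monom 1 (if continuant T (Suc n) then n else n - 1))"
    by (rule sum.reindex_bij_betw[OF bij])
  also have "\<dots> = (\<Sum>T\<in>singular_sets n. monom 1 (if continuant T (Suc n) then n else n - 1))
      + (\<Sum>T\<in>Pow {1..n} - singular_sets n. monom 1 (if continuant T (Suc n) then n else n - 1))"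
    by (subst add.commute, rule sum.subset_diff) (auto simp: singular_sets_def)
  also have "(\<Sum>T\<in>singular_sets n. monom 1 (if continuant T (Suc n) then n else n - 1))
      = (\<Sum>T\<in>singular_sets n. monom (1::rat) (n - 1))"
    by (intro sum.cong) (auto simp: singular_sets_def)
  also have "(\<Sum>T\<in>Pow {1..n} - singular_sets n. monom 1 (if continuant T (Suc n) then n else n - 1))
      = (\<Sum>T\<in>Pow {1..n} - singular_sets n. monom (1::rat) n)"
    by (intro sum.cong) (auto simp: singular_sets_def)
  finally have "petrial_polynomial B = of_nat (card (singular_sets n)) * monom 1 (n - 1)
      + of_nat (card (Pow {1..n} - singular_sets n)) * monom 1 n"
    by simp
  moreover have "card (singular_sets n) \<le> card (Pow {1..n})"
    by (intro card_mono) (auto simp: singular_sets_def)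
  then have "(of_nat (card (Pow {1..n} - singular_sets n)) :: rat) = 2 ^ n - of_nat (card (singular_sets n))"
    by (subst card_Diff_subset) (auto simp: singular_sets_def card_Pow)
  moreover have "of_nat m * monom 1 k = monom (of_nat m :: rat) k" for m k
    by (simp add: of_nat_poly smult_monom)
  ultimately show ?thesis by simp
qed

section \<open>An explicit bouquet for the path\<close>

text \<open>The chord word \<open>1 2 1 3 2 4 3 \<dots> (n + 1) n\<close>, to be closed by the second end of \<open>n + 1\<close>.\<close>

fun path_word :: "nat \<Rightarrow> (nat \<times> bool) list" where
  "path_word 0 = [(1, False)]"
| "path_word (Suc n) = path_word n @ [(n + 2, False), (n + 1, True)]"

definition path_bouquet :: "nat \<Rightarrow> nat ribbon_graph" where
  "path_bouquet n = \<lparr>discs = [path_word n @ [(n + 1, True)]], twisted = {}\<rparr>"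

lemma mem_path_word:
  "(k, b) \<in> set (path_word n) \<longleftrightarrow> 1 \<le> k \<and> k \<le> n + 1 \<and> (k = n + 1 \<longrightarrow> \<not> b)"
proof (induction n)
  case (Suc n)
  have "(k, b) \<in> set (path_word (Suc n)) \<longleftrightarrow>
      (k, b) \<in> set (path_word n) \<or> k = n + 2 \<and> \<not> b \<or> k = n + 1 \<and> b"
    by auto
  then show ?case
    unfolding Suc.IH by (cases b) auto
qed auto

lemma set_path_word_closed: "set (path_word n @ [(n + 1, True)]) = {1..n + 1} \<times> UNIV"
proof (rule set_eqI)
  fix p :: "nat \<times> bool"
  show "p \<in> set (path_word n @ [(n + 1, True)]) \<longleftrightarrow> p \<in> {1..n + 1} \<times> UNIV"
    by (cases p) (auto simp: mem_path_word)
qed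

lemma distinct_path_word: "distinct (path_word n)"
  by (induction n) (auto simp: mem_path_word)

text \<open>\<open>path_word m\<close> contains the first ends of the chords up to
  \<open>m + 1\<close> and the second ends of those up to \<open>m\<close>; the cases tell how far
  it has got. Each new chord opens just before its predecessor closes, so only consecutive chords
  alternate.\<close>

lemma filter_path_word:
  assumes "1 \<le> a" "a < b"
  shows "filter (\<lambda>e. e = a \<or> e = b) (map fst (path_word m)) =
    (if m + 1 < a then [] else if m + 1 = a then [a] else if m + 1 < b then [a, a]
     else if m + 1 = b then (if b = a + 1 then [a, b, a] else [a, a, b])
     else (if b = a + 1 then [a, b, a, b] else [a, a, b, b]))"
  using assms by (induction m) auto

lemma filter_path_word_same:
  assumes "1 \<le> a"
  shows "filter (\<lambda>e. e = a) (map fst (path_word m)) =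
    (if m + 1 < a then [] else if m + 1 = a then [a] else [a, a])"
  using assms by (induction m) auto

lemma concat_discs_path_bouquet: "concat (discs (path_bouquet n)) = path_word n @ [(n + 1, True)]"
  by (simp add: path_bouquet_def)

lemma edges_path_bouquet: "edges (path_bouquet n) = {1..n + 1}"
  unfolding edges_def concat_discs_path_bouquet set_path_word_closed by simp

lemma bouquet_path_bouquet: "bouquet (path_bouquet n)"
  unfolding bouquet_def wf_ribbon_graph_def num_vertices_def edges_path_bouquet
    concat_discs_path_bouquet set_path_word_closed
  by (simp add: path_bouquet_def mem_path_word distinct_path_word)

lemma interlaced_path_bouquet:
  "interlaced (path_bouquet n) a b \<longleftrightarrow>
     a \<in> {1..n + 1} \<and> b \<in> {1..n + 1} \<and> (b = a + 1 \<or> a = b + 1)"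
proof -
  let ?w = "map fst (path_word n @ [(n + 1, True)])"
  have set_w: "set ?w = {1..n + 1}"
    unfolding set_map set_path_word_closed by simp
  have sym: "interlaced (path_bouquet n) x y \<longleftrightarrow> interlaced (path_bouquet n) y x" for x y
    unfolding interlaced_def by (simp add: disj_commute insert_commute)
  have less: "interlaced (path_bouquet n) x y \<longleftrightarrow> y = x + 1"
    if "x < y" "x \<in> {1..n + 1}" "y \<in> {1..n + 1}" for x y
    using that filter_path_word[of x y n]
    by (auto simp: interlaced_def path_bouquet_def)
  \<comment> \<open>Interlacement does not mention the edge set; the letters of the alternating
    pattern must occur in the word.\<close>
  have mem: "x \<in> {1..n + 1} \<and> y \<in> {1..n + 1}" if "interlaced (path_bouquet n) x y" for x y
  proof -
    define f where "f = filter (\<lambda>e. e = x \<or> e = y) ?w"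
    have "f \<in> {[x, y, x, y], [y, x, y, x]}"
      using that by (simp add: f_def interlaced_def path_bouquet_def)
    then have "set f = {x, y}" by auto
    moreover have "set f \<subseteq> {1..n + 1}"
      unfolding f_def set_w[symmetric] by (rule filter_is_subset)
    ultimately show ?thesis by simp
  qed
  have irrefl: "\<not> interlaced (path_bouquet n) x x" for x
  proof
    assume x: "interlaced (path_bouquet n) x x"
    then have "1 \<le> x" using mem by fastforce
    then show False
      using x filter_path_word_same[of x n]
      by (auto simp: interlaced_def path_bouquet_def split: if_splits)
  qed
  show ?thesis
    using less[of a b] less[of b a] sym[of a b] mem[of a b] irrefl[of a]
    by (cases a b rule: linorder_cases) auto
qed

lemma represents_path_bouquet: "represents (path_bouquet n) (path_graph (n + 1))"
proof -
  have "intersection_graph (path_bouquet n) = path_graph (n + 1)"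
    by (auto simp: intersection_graph_def path_graph_def edges_path_bouquet interlaced_path_bouquet)
  moreover have "digraph_iso (with_proj (path_graph m)) (with_proj (path_graph m))" for m
    unfolding digraph_iso_def
    \<comment> \<open>The head and tail components must be the projections because
      \<open>app_iso\<close> installs them in the image.\<close>
    by (intro exI[of _ "\<lparr>iso_verts = id, iso_arcs = id, iso_head = snd, iso_tail = fst\<rparr>"])
      (auto simp: pre_digraph.digraph_isomorphism_def app_iso_def with_proj_def wf_digraph_def
        path_graph_def)
  ultimately show ?thesis
    by (simp add: represents_def bouquet_path_bouquet)
qed

theorem theorem4p2:
  fixes n :: nat
  assumes "n \<ge> 1"
  shows "circle_graph (path_graph n) \<and>
    circle_petrial_polynomial (path_graph n) =
      (if even n
       then monom ((2 ^ n - 1) / 3) (n - 1) + monom ((2 ^ (n + 1) + 1) / 3) n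
       else monom ((2 ^ n + 1) / 3) (n - 1) + monom ((2 ^ (n + 1) - 1) / 3) n)"
proof
  have rep: "represents (path_bouquet (n - 1)) (path_graph n)"
    using represents_path_bouquet[of "n - 1"] assms by simp
  then show "circle_graph (path_graph n)"
    by (auto simp: circle_graph_def)
  let ?s = "of_nat (card (singular_sets n)) :: rat"
  \<comment> \<open>\<open>path_bouquet\<close> gives existence for the definite description;
    uniqueness holds because \<open>petrial_polynomial_path\<close> yields the same value for every
    representing bouquet.\<close>
  have "circle_petrial_polynomial (path_graph n) = monom ?s (n - 1) + monom (2 ^ n - ?s) n"
    unfolding circle_petrial_polynomial_def
    using rep petrial_polynomial_path[OF _ assms] by (intro the_equality) auto
  moreover have "?s = (2 ^ n - (- 1) ^ n) / 3"
    using card_singular_sets[of n] by simp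
  ultimately show "circle_petrial_polynomial (path_graph n) =
      (if even n
       then monom ((2 ^ n - 1) / 3) (n - 1) + monom ((2 ^ (n + 1) + 1) / 3) n
       else monom ((2 ^ n + 1) / 3) (n - 1) + monom ((2 ^ (n + 1) - 1) / 3) n)"
    \<comment> \<open>The parity of \<open>n\<close> fixes the sign of \<open>(- 1) ^ n\<close>, and
      \<open>2 ^ n - ?s\<close> equals \<open>(2 ^ (n + 1) + (- 1) ^ n) / 3\<close>.\<close>
    by (simp add: field_simps)
qed

end
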